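(* Let $n\ge 4$ and let $A=(a_{ij})$ be a symmetric $n\times n$ matrix with entries in $\mathbb{R}\cup\{-\infty\}$, and let $\delta_0,\delta_1,\ldots,\delta_n$ be the coefficients of its tropical characteristic polynomial, where $\delta_k$ is the coefficient of the term of degree $n-k$. Then at least one of the following inequalities holds: (1) $\delta_4+\delta_2\le 2\delta_3$; (2) $\delta_4+2\delta_1\le 3\delta_2$.
   Context: The tropical semiring is $\mathbb{R}_{\max}=\mathbb{R}\cup\{-\infty\}$ with $a\oplus b=\max\{a,b\}$ and $a\otimes b=a+b$, where $-\infty + a=-\infty$ for all $a$, $-\infty$ is the least element, and positive integer multiples of $-\infty$ equal $-\infty$. The sums, multiples and inequalities in the claim are the usual ones under these conventions. A matrix $A$ is symmetric if $a_{ij}=a_{ji}$ for all $i,j$. For a square matrix $B=(b_{ij})$ of order $k$ over $\mathbb{R}_{\max}$, its tropical permanent is $\operatorname{maper}(B)=\max_{\sigma\in S_k}\sum_{i=1}^k b_{i,\sigma(i)}$. The tropical characteristic polynomial of $A\in\mathbb{R}_{\max}^{n\times n}$ is $\operatorname{maper}(A\oplus x\otimes I)$, where $I$ has $0$ on the diagonal and $-\infty$ elsewhere. It is written $\bigoplus_{k=0}^n \delta_k\otimes x^{\otimes(n-k)}=\max_{0\le k\le n}(\delta_k+(n-k)x)$, with coefficients $\delta_0=0$ and, for $1\le k\le n$, $\delta_k=\max_B \operatorname{maper}(B)$, the maximum being over all principal submatrices $B$ of $A$ of order $k$ (same index set of size $k$ for rows and columns). *)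

theory Defs
  imports "HOL-Analysis.Analysis"
begin

text \<open>
  The tropical semiring is rendered by \<^typ>\<open>ereal\<close>, restricted to values different from
  \<open>\<infinity>\<close>: there \<open>max\<close> and \<open>+\<close> are the tropical operations, and
  \<open>- \<infinity>\<close> is least and absorbing for \<open>+\<close>.

  A principal submatrix keeps its original index set \<open>S\<close> instead of being reindexed by
  \<open>1, \<dots>, k\<close>, so the permanent is taken relative to \<open>S\<close>.
\<close>

definition tropical_matrix :: "ereal ^ 'n ^ 'm \<Rightarrow> bool"
  where "tropical_matrix A \<longleftrightarrow> (\<forall>i j. A $ i $ j \<noteq> \<infinity>)"

definition maper_on :: "'n set \<Rightarrow> ereal ^ 'n ^ 'n \<Rightarrow> ereal"
  where "maper_on S A = Max ((\<lambda>\<sigma>. \<Sum>i\<in>S. A $ i $ \<sigma> i) ` {\<sigma>. \<sigma> permutes S})"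

definition maper :: "ereal ^ 'n ^ 'n \<Rightarrow> ereal"
  where "maper A = maper_on UNIV A"

text \<open>
  The formula gives value \<open>0\<close> at \<open>k = 0\<close> (see \<open>charcoeff_0\<close> below);
  it is meaningful only for \<open>k \<le> CARD('n)\<close>, since otherwise the maximum is over the empty set.
\<close>

definition charcoeff :: "ereal ^ 'n ^ 'n \<Rightarrow> nat \<Rightarrow> ereal"
  where "charcoeff A k = Max ((\<lambda>S. maper_on S A) ` {S. card S = k})"

definition charpoly :: "ereal ^ 'n ^ 'n \<Rightarrow> ereal \<Rightarrow> ereal"
  where "charpoly A x = maper (\<chi> i j. max (A $ i $ j) (x + (if i = j then 0 else - \<infinity>)))"

lemma charcoeff_0: "charcoeff (A :: ereal ^ 'n ^ 'n) 0 = 0"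
proof -
  have "{S :: 'n set. card S = 0} = {{}}" by auto
  then show ?thesis by (simp add: charcoeff_def maper_on_def)
qed

lemma sum_const_ereal: "finite S \<Longrightarrow> (\<Sum>i\<in>S. x :: ereal) = ereal (real (card S)) * x"
proof (induction S rule: finite_induct)
  case (insert a S)
  have "ereal (1 + real (card S)) * x = ereal 1 * x + ereal (real (card S)) * x"
    unfolding plus_ereal.simps(1)[symmetric] by (rule ereal_left_distrib) auto
  with insert show ?case by (simp add: add.commute one_ereal_def[symmetric])
qed (simp add: zero_ereal_def[symmetric])

theorem charpoly_eq:
  fixes A :: "ereal ^ 'n ^ 'n"
  assumes x: "x \<noteq> \<infinity>"
  shows "charpoly A x = Max ((\<lambda>k. charcoeff A k + ereal (real (CARD('n) - k)) * x) ` {0..CARD('n)})"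
    (is "_ = Max (?g ` _)")
proof -
  let ?B = "\<chi> i j. max (A $ i $ j) (x + (if i = j then 0 else - \<infinity>))"
  have B: "?B $ i $ j = (if i = j then max (A $ i $ i) x else A $ i $ j)" for i j
    using x by (cases x; cases "A $ i $ j") auto
  have split: "(\<Sum>i\<in>UNIV. f i) = (\<Sum>i\<in>S. f i) + (\<Sum>i\<in>-S. f i)" for f :: "'n \<Rightarrow> ereal" and S
    by (metis Compl_eq_Diff_UNIV add.commute finite sum.subset_diff top_greatest)
  have cc: "card (- S) = CARD('n) - card S" for S :: "'n set"
    by (simp add: Compl_eq_Diff_UNIV card_Diff_subset)
  have fin: "finite {\<sigma>. \<sigma> permutes S}" for S :: "'n set"
    by (simp add: finite_permutations)
  have "charpoly A x \<le> Max (?g ` {0..CARD('n)})"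
    unfolding charpoly_def maper_def maper_on_def
  proof (rule Max.boundedI)
    fix s assume "s \<in> (\<lambda>\<sigma>. \<Sum>i\<in>UNIV. ?B $ i $ \<sigma> i) ` {\<sigma>. \<sigma> permutes (UNIV :: 'n set)}"
    then obtain \<sigma> where s: "s = (\<Sum>i\<in>UNIV. ?B $ i $ \<sigma> i)"
      and \<sigma>: "\<sigma> permutes (UNIV :: 'n set)" by blast
    define S where "S = - {i. \<sigma> i = i \<and> A $ i $ i \<le> x}"
    have "s = (\<Sum>i\<in>S. A $ i $ \<sigma> i) + (\<Sum>i\<in>-S. x)"
      unfolding s split[of _ S] B
      by (intro arg_cong2[where f="(+)"] sum.cong) (auto simp: S_def max_def)
    also have "\<sigma> permutes S"
      using \<sigma> by (auto simp: S_def permutes_def)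
    then have "(\<Sum>i\<in>S. A $ i $ \<sigma> i) \<le> maper_on S A"
      unfolding maper_on_def by (intro Max_ge) (auto simp: fin)
    also have "maper_on S A \<le> charcoeff A (card S)"
      unfolding charcoeff_def by (intro Max_ge) auto
    finally have "s \<le> ?g (card S)"
      by (simp add: sum_const_ereal cc add_mono add_right_mono)
    also have "\<dots> \<le> Max (?g ` {0..CARD('n)})"
      by (intro Max_ge) (auto simp: card_mono)
    finally show "s \<le> Max (?g ` {0..CARD('n)})" .
  qed (auto simp: fin intro: permutes_id)
  moreover have "Max (?g ` {0..CARD('n)}) \<le> charpoly A x"
  proof (rule Max.boundedI)
    fix t assume "t \<in> ?g ` {0..CARD('n)}"
    then obtain k where k: "k \<le> CARD('n)" and t: "t = ?g k" by auto
    obtain S0 :: "'n set" where "card S0 = k"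
      using k by (metis obtain_subset_with_card_n)
    then have "charcoeff A k \<in> (\<lambda>S. maper_on S A) ` {S. card S = k}"
      unfolding charcoeff_def by (intro Max_in) auto
    then obtain S where S: "card S = k" "charcoeff A k = maper_on S A" by auto
    have "maper_on S A \<in> (\<lambda>\<sigma>. \<Sum>i\<in>S. A $ i $ \<sigma> i) ` {\<sigma>. \<sigma> permutes S}"
      unfolding maper_on_def by (intro Max_in) (auto simp: fin intro: permutes_id)
    then obtain \<sigma> where \<sigma>: "\<sigma> permutes S" "maper_on S A = (\<Sum>i\<in>S. A $ i $ \<sigma> i)" by auto
    have "t = (\<Sum>i\<in>S. A $ i $ \<sigma> i) + (\<Sum>i\<in>-S. x)"
      using t S \<sigma> by (simp add: sum_const_ereal cc)
    also have "\<dots> \<le> (\<Sum>i\<in>UNIV. ?B $ i $ \<sigma> i)"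
      unfolding split[of _ S] B
      by (intro add_mono sum_mono) (use \<sigma>(1) in \<open>auto simp: permutes_not_in\<close>)
    also have "\<dots> \<le> charpoly A x"
      unfolding charpoly_def maper_def maper_on_def
      by (intro Max_ge) (use fin permutes_subset[OF \<sigma>(1)] in auto)
    finally show "t \<le> charpoly A x" .
  qed auto
  ultimately show ?thesis by (rule antisym)
qed

end

theory Submission
  imports Defs
begin

text \<open>
  Entries \<open>-\<infinity>\<close> are removed by truncating \<open>A\<close> at \<open>-N\<close>: the coefficients converge as
  \<open>N \<rightarrow> \<infinity>\<close>, and the failure of both inequalities is an open condition.

  For a real symmetric matrix view permutations as covers by loops, doubled edges and longer cycles.
  Since a 4-cycle is dominated by a pair of doubled edges, \<open>\<delta>\<^sub>4\<close> is attained by four loops, two loops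
  and an edge, two edges, or a triangle and a loop. In each case the cycles of an optimal 4-cover and
  an optimal 2-cover, together with a heaviest loop, recombine into covers of order 2 and 3, and
  adding up the resulting bounds contradicts the failure of both inequalities. The critical case is a
  triangle with a loop \<open>w\<close> whose vertex \<open>x\<close> carries the heaviest loop and \<open>\<delta>\<^sub>2 = 2 a\<^sub>x\<^sub>w\<close>.
\<close>

section \<open>Attainment and continuity of the coefficients\<close>

lemma charcoeff_ge:
  fixes A :: "ereal ^ 'n ^ 'n"
  assumes "\<sigma> permutes S"
  shows "(\<Sum>i\<in>S. A $ i $ \<sigma> i) \<le> charcoeff A (card S)"
proof -
  have "(\<Sum>i\<in>S. A $ i $ \<sigma> i) \<le> maper_on S A"
    unfolding maper_on_def using assms by (intro Max_ge) (auto simp: finite_permutations)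
  also have "\<dots> \<le> charcoeff A (card S)"
    unfolding charcoeff_def by (intro Max_ge) auto
  finally show ?thesis .
qed

lemma charcoeff_attained:
  fixes A :: "ereal ^ 'n ^ 'n"
  assumes "k \<le> CARD('n)"
  obtains S \<sigma> where "card S = k" "\<sigma> permutes S" "charcoeff A k = (\<Sum>i\<in>S. A $ i $ \<sigma> i)"
proof -
  obtain S0 :: "'n set" where "card S0 = k"
    using assms by (metis obtain_subset_with_card_n)
  then have "charcoeff A k \<in> (\<lambda>S. maper_on S A) ` {S. card S = k}"
    unfolding charcoeff_def by (intro Max_in) auto
  then obtain S where S: "card S = k" "charcoeff A k = maper_on S A" by auto
  have "maper_on S A \<in> (\<lambda>\<sigma>. \<Sum>i\<in>S. A $ i $ \<sigma> i) ` {\<sigma>. \<sigma> permutes S}"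
    unfolding maper_on_def
    by (intro Max_in) (auto simp: finite_permutations intro: permutes_id)
  with S that show ?thesis by auto
qed

lemma tendsto_Max:
  fixes f :: "'i \<Rightarrow> 'a \<Rightarrow> 'b :: linorder_topology"
  assumes "finite I" "I \<noteq> {}" "\<And>i. i \<in> I \<Longrightarrow> (f i \<longlongrightarrow> l i) F"
  shows "((\<lambda>x. Max ((\<lambda>i. f i x) ` I)) \<longlongrightarrow> Max (l ` I)) F"
  using assms
proof (induction I rule: finite_ne_induct)
  case (insert i I)
  then show ?case by (simp add: tendsto_max)
qed simp

lemma sum_ereal_neq_PInf:
  fixes f :: "'i \<Rightarrow> ereal"
  assumes "\<And>i. i \<in> I \<Longrightarrow> f i \<noteq> \<infinity>"
  shows "sum f I \<noteq> \<infinity>"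
  using assms by (simp add: sum_Pinfty)

text \<open>Addition on \<open>ereal\<close> is discontinuous only where \<infinity> meets
  -\<infinity>; excluding the limit \<infinity> avoids this and still admits -\<infinity>.\<close>

lemma tendsto_sum_ereal_neq_PInf:
  fixes f :: "'i \<Rightarrow> 'a \<Rightarrow> ereal"
  assumes "finite I" "\<And>i. i \<in> I \<Longrightarrow> (f i \<longlongrightarrow> l i) F" "\<And>i. i \<in> I \<Longrightarrow> l i \<noteq> \<infinity>"
  shows "((\<lambda>x. \<Sum>i\<in>I. f i x) \<longlongrightarrow> sum l I) F"
  using assms
proof (induction I rule: finite_induct)
  case (insert i I)
  then have "sum l I \<noteq> \<infinity>" by (intro sum_ereal_neq_PInf) auto
  with insert show ?case by (auto intro!: tendsto_add_ereal_general)
qed simp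

lemma tendsto_charcoeff:
  fixes A :: "ereal ^ 'n ^ 'n"
  assumes "tropical_matrix A" "k \<le> CARD('n)" "\<And>i j. ((\<lambda>N. B N $ i $ j) \<longlongrightarrow> A $ i $ j) F"
  shows "((\<lambda>N. charcoeff (B N) k) \<longlongrightarrow> charcoeff A k) F"
proof -
  have "\<exists>S :: 'n set. card S = k"
    using assms(2) by (metis obtain_subset_with_card_n)
  then show ?thesis
    using assms unfolding charcoeff_def maper_on_def tropical_matrix_def
    by (intro tendsto_Max tendsto_sum_ereal_neq_PInf) (auto simp: finite_permutations intro: permutes_id)
qed

lemma charcoeff_neq_PInf:
  fixes A :: "ereal ^ 'n ^ 'n"
  assumes "tropical_matrix A" "k \<le> CARD('n)"
  shows "charcoeff A k \<noteq> \<infinity>"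
proof -
  obtain S \<sigma> where "charcoeff A k = (\<Sum>i\<in>S. A $ i $ \<sigma> i)"
    using charcoeff_attained[OF assms(2)] by metis
  moreover have "(\<Sum>i\<in>S. A $ i $ \<sigma> i) \<noteq> \<infinity>"
    using assms(1) by (intro sum_ereal_neq_PInf) (simp add: tropical_matrix_def)
  ultimately show ?thesis by simp
qed

text \<open>The hypothetical counterexample: \<open>not1\<close> and \<open>not2\<close> negate the two inequalities, so the
  aim inside the locale is a contradiction. Four-cycles are omitted from the bounds on \<open>d4\<close>.\<close>

locale symmetric_cycle_bounds =
  fixes a :: "'n \<Rightarrow> 'n \<Rightarrow> real" and d1 d2 d3 d4 :: real and p :: 'n
  assumes sym: "a i j = a j i"
    and le1: "a i i \<le> d1"
    and loops2: "i \<noteq> j \<Longrightarrow> a i i + a j j \<le> d2"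
    and edge2: "i \<noteq> j \<Longrightarrow> 2 * a i j \<le> d2"
    and loops3: "distinct [i, j, k] \<Longrightarrow> a i i + a j j + a k k \<le> d3"
    and edge3: "distinct [i, j, k] \<Longrightarrow> a i i + 2 * a j k \<le> d3"
    and triangle3: "distinct [i, j, k] \<Longrightarrow> a i j + a j k + a k i \<le> d3"
    and loops4: "distinct [i, j, k, l] \<Longrightarrow> a i i + a j j + a k k + a l l \<le> d4"
    and edge4: "distinct [i, j, k, l] \<Longrightarrow> a i i + a j j + 2 * a k l \<le> d4"
    and edges4: "distinct [i, j, k, l] \<Longrightarrow> 2 * a i j + 2 * a k l \<le> d4"
    and triangle4: "distinct [i, j, k, l] \<Longrightarrow> a i j + a j k + a k i + a l l \<le> d4"
    and att1: "d1 = a p p"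
    and att2: "\<exists>u v. u \<noteq> v \<and> (d2 = a u u + a v v \<or> d2 = 2 * a u v)"
    and not1: "2 * d3 < d4 + d2"
    and not2: "3 * d2 < d4 + 2 * d1"
begin

section \<open>Exclusion of the cycle types of an optimal 4-cover\<close>

text \<open>Loop \<open>p\<close> pairs with three of the loops and the fourth weighs at most
  \<open>d1\<close>; the three bounds by \<open>d2\<close> add up to
  \<open>d4 + 2 * d1 \<le> 3 * d2\<close>.\<close>

lemma not_loops:
  assumes "distinct [x, y, z, w]"
  shows "d4 \<noteq> a x x + a y y + a z z + a w w"
proof
  assume d4: "d4 = a x x + a y y + a z z + a w w"
  note l = loops2[of p x] loops2[of p y] loops2[of p z] loops2[of p w]
    le1[of x] le1[of y] le1[of z] le1[of w] att1 not2 d4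
  consider "p = x" | "p = y" | "p = z" | "p \<noteq> x" "p \<noteq> y" "p \<noteq> z" by blast
  then show False using l assms by cases auto
qed

text \<open>An edge avoiding \<open>p\<close> forms a 3-cover with loop \<open>p\<close>. If both
  edges do, \<open>not1\<close> gives \<open>2 * d1 < d2\<close> and \<open>not2\<close> the
  reverse. If only \<open>zw\<close> does, they put \<open>d1 + a z w\<close> strictly on both sides
  of \<open>d2\<close>.\<close>

lemma not_edges:
  assumes "distinct [x, y, z, w]"
  shows "d4 \<noteq> 2 * a x y + 2 * a z w"
proof
  assume d4: "d4 = 2 * a x y + 2 * a z w"
  note l = edge2[of x y] edge2[of z w] edge3[of p x y] edge3[of p z w] att1 not1 not2 d4
  consider "p \<notin> {x, y, z, w}" | "p \<in> {x, y}" "p \<notin> {z, w}" | "p \<in> {z, w}" "p \<notin> {x, y}"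
    using assms by auto
  then show False using l assms by cases auto
qed

text \<open>Where possible, the cycles of both covers are regrouped into two 3-covers, so that
  \<open>d4 + d2 \<le> 2 * d3\<close>; otherwise \<open>not2\<close> or the optimality of
  \<open>d4\<close> helps.\<close>

lemma not_edge_if_loops2:
  assumes "distinct [x, y, z, w]" "u \<noteq> v" "d2 = a u u + a v v" "a u u = d1"
  shows "d4 \<noteq> a x x + a y y + 2 * a z w"
proof
  assume d4: "d4 = a x x + a y y + 2 * a z w"
  have main: False if "distinct [x, y, z, w]" "d4 = a x x + a y y + 2 * a z w" "u = x" for x y z w
  proof (cases "v = y")
    case True
    then show False using edge3[of x z w] that assms not1 not2 by auto
  next
    case False
    then show False using edge3[of x z w] loops3[of x y v] that assms not1 by auto
  qed
  have main2: False if "distinct [x, y, z, w]" "d4 = a x x + a y y + 2 * a z w" "u = z" for x y z w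
  proof -
    note xyzw = that
    note f = edge3[of x z w] edge3[of y z w] xyzw assms(2-) not1
    consider "v = x" | "v = y" | "v = w" | "distinct [z, v, y]" "v \<noteq> x"
      using xyzw assms(2) by auto
    then show False
    proof cases
      case 1
      then show False using f loops3[of z x y] by auto
    next
      case 2
      then show False using f loops3[of z x y] by auto
    next
      case 3
      \<comment> \<open>Comparison with four loops gives \<open>d2 \<le> 2 * a z w\<close>, so a
        second copy of the edge replaces the 2-cover.\<close>
      then show False using f loops4[of x y z w] by auto
    next
      case 4
      then show False using f loops3[of z v y] by auto
    qed
  qed
  consider "u = x" | "u = y" | "u = z" | "u = w" | "distinct [u, y, z, w]" "u \<noteq> x"
    using assms by auto
  then show False
  proof cases
    case 1
    then show False using main assms d4 by blast
  next
    case 2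
    then show False using main[of y x z w] assms d4 by auto
  next
    case 3
    then show False using main2 assms d4 by blast
  next
    case 4
    then show False using main2[of x y w z] assms d4 sym[of z w] by auto
  next
    case 5
    \<comment> \<open>Loop \<open>u\<close> in place of loop \<open>x\<close> or \<open>y\<close>
      cannot improve on \<open>d4\<close>; hence all three weigh \<open>d1\<close> and
      \<open>d2 = 2 * d1\<close>.\<close>
    then have "d1 \<le> a x x" "d1 \<le> a y y"
      using edge4[of u y z w] edge4[of u x z w] assms d4 by auto
    then show False
      using edge3[of x z w] edge3[of y z w] loops3[of u x y] loops2[of x y]
        le1[of v] le1[of x] le1[of y] assms d4 5 not1 not2
      by auto
  qed
qed

text \<open>Unless \<open>p\<close> is \<open>v\<close>, exchanging loop \<open>u\<close> for loop
  \<open>p\<close> gives another 2-cover.\<close>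

lemma loops2_max:
  assumes "u \<noteq> v" "d2 = a u u + a v v"
  shows "a u u = d1 \<or> a v v = d1"
  using assms loops2[of p v] le1[of u] att1 by (cases "p = v") auto

text \<open>The 2-cover is now an edge \<open>uv\<close>. A loop off \<open>uv\<close> joins it, the
  other loop joins \<open>zw\<close>, and two 3-covers result.\<close>

lemma not_edge:
  assumes "distinct [x, y, z, w]"
  shows "d4 \<noteq> a x x + a y y + 2 * a z w"
proof
  assume d4: "d4 = a x x + a y y + 2 * a z w"
  have loops: False if "u \<noteq> v" "d2 = a u u + a v v" for u v
    using loops2_max[OF that] not_edge_if_loops2[OF assms] that d4
    by (metis add.commute)
  obtain u v where uv: "u \<noteq> v" "d2 = a u u + a v v \<or> d2 = 2 * a u v"
    using att2 by blast
  then have d2: "d2 = 2 * a u v" using loops by blast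
  note f = d2 uv(1) edge3[of x z w] edge3[of y z w] edge3[of x u v] edge3[of y u v] assms d4 not1
  consider "x \<notin> {u, v}" | "y \<notin> {u, v}" | "{u, v} = {x, y}" using uv assms by auto
  then show False
  proof cases
    case 3
    \<comment> \<open>Comparison with two edges gives \<open>2 * a x y \<le> a x x + a y y\<close>,
      so two loops attain \<open>d2\<close> as well.\<close>
    then have "d2 = 2 * a x y" using d2 sym[of x y] by (auto simp: doubleton_eq_iff)
    then show False using edges4[of x y z w] loops2[of x y] loops[of x y] d4 assms by auto
  qed (use f in auto)
qed

text \<open>Loop \<open>w\<close> with each side of the triangle in turn gives
  \<open>2 * d4 + d1 \<le> 3 * d3\<close>, which \<open>not1\<close> turns into
  \<open>d4 + 2 * d1 < 3 * d2\<close>.\<close>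

lemma not_triangle_if_loop_max:
  assumes "distinct [x, y, z, w]" "d1 \<le> a w w"
  shows "d4 \<noteq> a x y + a y z + a z x + a w w"
proof
  assume "d4 = a x y + a y z + a z x + a w w"
  then show False
    using assms edge3[of w x y] edge3[of w y z] edge3[of w z x] le1[of w] not1 not2
    by auto
qed

text \<open>The triangle is a 3-cover, so \<open>a w w + d2 \<le> d3\<close> contradicts
  \<open>not1\<close>. This bound holds if the 2-cover avoids \<open>w\<close>, and also if it is an
  edge avoiding \<open>x\<close>, since loop \<open>x\<close> outweighs loop
  \<open>w\<close>.\<close>

lemma not_triangle_if_vertex_max:
  assumes "distinct [x, y, z, w]" "p = x"
  shows "d4 \<noteq> a x y + a y z + a z x + a w w"
proof
  assume d4: "d4 = a x y + a y z + a z x + a w w"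
  obtain u v where uv: "u \<noteq> v" "d2 = a u u + a v v \<or> d2 = 2 * a u v"
    using att2 by blast
  note f = d4 assms att1 not1 not2 triangle3[of x y z] edge3[of w x y] edge3[of w y z]
    edge3[of w z x] edge3[of x y z] loops2[of x w] le1[of w] le1[of u] le1[of v]
  from uv(2) show False
  proof
    assume d2: "d2 = a u u + a v v"
    show False
    proof (cases "w \<in> {u, v}")
      case True
      \<comment> \<open>By \<open>not2\<close> the triangle then outweighs
        \<open>a w w + d2\<close>, so \<open>d4 + d2\<close> is below two triangles.\<close>
      then have "d2 = a x x + a w w" using d2 f by auto
      then show False using f by auto
    next
      case False
      then show False using d2 uv(1) f loops3[of u v w] by auto
    qed
  next
    assume d2: "d2 = 2 * a u v"
    consider "w \<notin> {u, v}" | "x \<notin> {u, v}" | "{u, v} = {x, w}" using uv assms by auto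
    then show False
    proof cases
      case 1
      then show False using d2 uv(1) f edge3[of w u v] by auto
    next
      case 2
      then show False using d2 uv(1) f edge3[of x u v] by auto
    next
      case 3
      \<comment> \<open>Loop \<open>w\<close> with the sides \<open>xy\<close> and
        \<open>zx\<close>, and loop \<open>x\<close> with \<open>yz\<close>, again give
        \<open>2 * d4 + d1 \<le> 3 * d3\<close>.\<close>
      then show False using d2 f by auto
    qed
  qed
qed

text \<open>If \<open>p\<close> is off the triangle, it can replace \<open>w\<close>, whence
  \<open>d1 \<le> a w w\<close>; otherwise a rotation of the triangle moves \<open>p\<close> to
  \<open>x\<close>.\<close>

lemma not_triangle:
  assumes "distinct [x, y, z, w]"
  shows "d4 \<noteq> a x y + a y z + a z x + a w w"
proof
  assume d4: "d4 = a x y + a y z + a z x + a w w"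
  consider "p = x" | "p = y" | "p = z" | "d1 \<le> a w w"
    using triangle4[of x y z p] assms d4 att1 by fastforce
  then show False
  proof cases
    case 1
    then show False using not_triangle_if_vertex_max assms d4 by blast
  next
    case 2
    then show False using not_triangle_if_vertex_max[of y z x w] assms d4 by auto
  next
    case 3
    then show False using not_triangle_if_vertex_max[of z x y w] assms d4 by auto
  next
    case 4
    then show False using not_triangle_if_loop_max assms d4 by blast
  qed
qed

end

section \<open>Cycle types on two and four points\<close>

lemma card_eq_4_iff: "card S = 4 \<longleftrightarrow> (\<exists>x y z w. S = {x, y, z, w} \<and> distinct [x, y, z, w])"
proof
  assume "card S = 4"
  then show "\<exists>x y z w. S = {x, y, z, w} \<and> distinct [x, y, z, w]"
    by (auto simp: eval_nat_numeral card_Suc_eq)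
qed auto

lemma permutes_2_sum_cases:
  fixes a :: "'n \<Rightarrow> 'n \<Rightarrow> real"
  assumes "\<sigma> permutes {x, y}" "x \<noteq> y" "a x y = a y x"
  shows "(\<Sum>i\<in>{x, y}. a i (\<sigma> i)) \<in> {a x x + a y y, 2 * a x y}"
proof -
  have "\<sigma> x \<in> {x, y}" "\<sigma> y \<in> {x, y}" "\<sigma> x \<noteq> \<sigma> y"
    using assms permutes_in_image[OF assms(1)] permutes_inj[OF assms(1)] by (auto simp: inj_eq)
  then show ?thesis using assms by auto
qed

text \<open>A 4-cycle has the mean weight of the two perfect matchings it consists of, so it never
  exceeds the heavier one.\<close>

lemma permutes_4_sum_cases:
  fixes a :: "'n \<Rightarrow> 'n \<Rightarrow> real"
  assumes \<sigma>: "\<sigma> permutes S" and "card S = 4" and sym: "\<And>i j. a i j = a j i"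
  obtains x y z w where "distinct [x, y, z, w]"
    "(\<Sum>i\<in>S. a i (\<sigma> i)) \<le> a x x + a y y + a z z + a w w \<or>
     (\<Sum>i\<in>S. a i (\<sigma> i)) \<le> a x x + a y y + 2 * a z w \<or>
     (\<Sum>i\<in>S. a i (\<sigma> i)) \<le> 2 * a x y + 2 * a z w \<or>
     (\<Sum>i\<in>S. a i (\<sigma> i)) \<le> a x y + a y z + a z x + a w w"
proof -
  obtain x y z w where S: "S = {x, y, z, w}" and d: "distinct [x, y, z, w]"
    using assms(2) unfolding card_eq_4_iff by blast
  have inj: "\<sigma> x \<noteq> \<sigma> y" "\<sigma> x \<noteq> \<sigma> z" "\<sigma> x \<noteq> \<sigma> w" "\<sigma> y \<noteq> \<sigma> z" "\<sigma> y \<noteq> \<sigma> w" "\<sigma> z \<noteq> \<sigma> w"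
    using d permutes_inj[OF \<sigma>] by (auto simp: inj_eq)
  have "\<sigma> x = x \<or> \<sigma> x = y \<or> \<sigma> x = z \<or> \<sigma> x = w" "\<sigma> y = x \<or> \<sigma> y = y \<or> \<sigma> y = z \<or> \<sigma> y = w"
    "\<sigma> z = x \<or> \<sigma> z = y \<or> \<sigma> z = z \<or> \<sigma> z = w" "\<sigma> w = x \<or> \<sigma> w = y \<or> \<sigma> w = z \<or> \<sigma> w = w"
    using permutes_in_image[OF \<sigma>] S by auto
  moreover define s where "s = a x (\<sigma> x) + a y (\<sigma> y) + a z (\<sigma> z) + a w (\<sigma> w)"
  moreover have sym': "a y x = a x y" "a z x = a x z" "a w x = a x w" "a z y = a y z"
    "a w y = a y w" "a w z = a z w"
    by (rule sym)+
  \<comment> \<open>Reversed cycles weigh the same, so 24 permutations leave 17 forms: the identity,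
    six edges, three edge pairs, four triangles, three 4-cycles.\<close>
  ultimately have cases: "s = a x x + a y y + a z z + a w w
    \<or> s = a x x + a y y + 2 * a z w \<or> s = a x x + a z z + 2 * a y w
    \<or> s = a x x + a w w + 2 * a y z \<or> s = a y y + a z z + 2 * a x w
    \<or> s = a y y + a w w + 2 * a x z \<or> s = a z z + a w w + 2 * a x y
    \<or> s = 2 * a x y + 2 * a z w \<or> s = 2 * a x z + 2 * a y w \<or> s = 2 * a x w + 2 * a y z
    \<or> s = a x y + a y z + a z x + a w w \<or> s = a x y + a y w + a w x + a z z
    \<or> s = a x z + a z w + a w x + a y y \<or> s = a y z + a z w + a w y + a x x
    \<or> s = a x y + a y z + a z w + a w x \<or> s = a x y + a y w + a w z + a z x
    \<or> s = a x z + a z y + a y w + a w x"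
    using inj by (elim disjE; simp)
  have s: "(\<Sum>i\<in>S. a i (\<sigma> i)) = s"
    using d by (simp add: S s_def algebra_simps)
  note obt = that[unfolded s]
  show ?thesis
  proof (rule ccontr)
    assume "\<not> thesis"
    \<comment> \<open>The labelling in the goal is existential, so its negation gives strict bounds
      for every relabelling.\<close>
    then have gt: "a x y + a y z + a z x + a w w < s" "2 * a x y + 2 * a z w < s"
      "a x x + a y y + 2 * a z w < s" "a x x + a y y + a z z + a w w < s"
      if "distinct [x, y, z, w]" for x y z w
      using obt[OF that] \<open>\<not> thesis\<close> by - (metis not_le)+
    have "a x x + a y y + a z z + a w w < s"
      "a x x + a y y + 2 * a z w < s" "a x x + a z z + 2 * a y w < s"
      "a x x + a w w + 2 * a y z < s" "a y y + a z z + 2 * a x w < s"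
      "a y y + a w w + 2 * a x z < s" "a z z + a w w + 2 * a x y < s"
      "2 * a x y + 2 * a z w < s" "2 * a x z + 2 * a y w < s" "2 * a x w + 2 * a y z < s"
      "a x y + a y z + a z x + a w w < s" "a x y + a y w + a w x + a z z < s"
      "a x z + a z w + a w x + a y y < s" "a y z + a z w + a w y + a x x < s"
      using d by (intro gt; auto)+
    with cases sym' show False
      by (elim disjE) linarith+
  qed
qed

section \<open>Real symmetric matrices\<close>

lemma real_matrix_charcoeff_ineqs:
  fixes A :: "ereal ^ 'n ^ 'n" and a :: "'n \<Rightarrow> 'n \<Rightarrow> real"
  assumes card: "CARD('n) \<ge> 4" and A: "\<And>i j. A $ i $ j = ereal (a i j)"
    and sym: "\<And>i j. a i j = a j i"
  shows "charcoeff A 4 + charcoeff A 2 \<le> 2 * charcoeff A 3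
       \<or> charcoeff A 4 + 2 * charcoeff A 1 \<le> 3 * charcoeff A 2"
proof (rule ccontr)
  assume neg: "\<not> ?thesis"
  have att: "\<exists>S \<sigma>. card S = k \<and> \<sigma> permutes S \<and> charcoeff A k = ereal (\<Sum>i\<in>S. a i (\<sigma> i))"
    if "k \<le> CARD('n)" for k
    using charcoeff_attained[OF that, of A] unfolding A sum_ereal by metis
  then have real: "\<exists>d. charcoeff A k = ereal d" if "k \<le> CARD('n)" for k
    using that by blast
  obtain d1 d2 d3 d4 where
    c: "charcoeff A 1 = ereal d1" "charcoeff A 2 = ereal d2" "charcoeff A 3 = ereal d3"
      "charcoeff A 4 = ereal d4"
    using real[of 1] real[of 2] real[of 3] real[of 4] card by auto
  have ge: "(\<Sum>i\<in>S. a i (\<sigma> i)) \<le> d"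
    if "\<sigma> permutes S" "card S = k" "charcoeff A k = ereal d" for \<sigma> S k d
    using charcoeff_ge[OF that(1), of A] that(2,3) by (simp add: A)
  have transp: "Transposition.transpose i j permutes S" if "i \<in> S" "j \<in> S" for i j :: 'n and S
    using that by (rule permutes_swap_id)
  \<comment> \<open>This is the 3-cycle sending \<open>i\<close> to \<open>j\<close>,
    \<open>j\<close> to \<open>k\<close> and \<open>k\<close> to \<open>i\<close>.\<close>
  have cyc: "Transposition.transpose i j \<circ> Transposition.transpose j k permutes S"
    if "i \<in> S" "j \<in> S" "k \<in> S" for i j k :: 'n and S
    using that by (intro permutes_compose transp)
  obtain p where p: "d1 = a p p"
  proof -
    obtain S \<sigma> where S: "card S = 1" "\<sigma> permutes S" "charcoeff A 1 = ereal (\<Sum>i\<in>S. a i (\<sigma> i))"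
      using att[of 1] card by auto
    then obtain q where "S = {q}" by (auto simp: card_1_singleton_iff)
    with S c that show ?thesis by (auto simp: permutes_sing)
  qed
  have "\<exists>u v. u \<noteq> v \<and> (d2 = a u u + a v v \<or> d2 = 2 * a u v)"
  proof -
    obtain S \<sigma> where S: "card S = 2" "\<sigma> permutes S" "charcoeff A 2 = ereal (\<Sum>i\<in>S. a i (\<sigma> i))"
      using att[of 2] card by auto
    then obtain u v where "S = {u, v}" "u \<noteq> v" by (auto simp: card_2_iff)
    with S c permutes_2_sum_cases[of \<sigma> u v a] sym[of u v] show ?thesis
      by (metis (no_types, lifting) ereal.inject insertE singletonD)
  qed
  then interpret symmetric_cycle_bounds a d1 d2 d3 d4 p
  proof unfold_locales
    show "2 * d3 < d4 + d2" "3 * d2 < d4 + 2 * d1" using neg by (auto simp: c simp del: One_nat_def)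
    show "a i i \<le> d1" for i
      using ge[OF permutes_id[of "{i}"] _ c(1)] by simp
    show "a i i + a j j \<le> d2" if "i \<noteq> j" for i j
      using ge[OF permutes_id[of "{i, j}"] _ c(2)] that by simp
    show "2 * a i j \<le> d2" if "i \<noteq> j" for i j
      using ge[OF transp[of i "{i, j}" j] _ c(2)] that sym[of i j] by simp
    fix i j k :: 'n assume d: "distinct [i, j, k]"
    show "a i i + a j j + a k k \<le> d3"
      using ge[OF permutes_id[of "{i, j, k}"] _ c(3)] d by (simp add: add.assoc)
    show "a i i + 2 * a j k \<le> d3"
      using ge[OF transp[of j "{i, j, k}" k] _ c(3)] d sym[of j k] by simp
    show "a i j + a j k + a k i \<le> d3"
      using ge[OF cyc[of i "{i, j, k}" j k] _ c(3)] d by (auto simp: Transposition.transpose_def)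
  next
    fix i j k l :: 'n assume d: "distinct [i, j, k, l]"
    show "a i i + a j j + a k k + a l l \<le> d4"
      using ge[OF permutes_id[of "{i, j, k, l}"] _ c(4)] d by (simp add: add.assoc)
    show "a i i + a j j + 2 * a k l \<le> d4"
      using ge[OF transp[of k "{i, j, k, l}" l] _ c(4)] d sym[of k l] by simp
    show "2 * a i j + 2 * a k l \<le> d4"
      using ge[OF permutes_compose[OF transp[of i "{i, j, k, l}" j] transp[of k "{i, j, k, l}" l]]
          _ c(4)] d sym[of i j] sym[of k l]
      by (auto simp: Transposition.transpose_def)
    show "a i j + a j k + a k i + a l l \<le> d4"
      using ge[OF cyc[of i "{i, j, k, l}" j k] _ c(4)] d by (auto simp: Transposition.transpose_def)
  qed (use sym p in auto)
  obtain S \<sigma> where S: "card S = 4" "\<sigma> permutes S" "d4 = (\<Sum>i\<in>S. a i (\<sigma> i))"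
    using att[of 4] card c by auto
  show False
  proof (rule permutes_4_sum_cases[OF S(2,1), of a])
    fix x y z w :: 'n
    assume d: "distinct [x, y, z, w]"
    \<comment> \<open>Each type is bounded by \<open>d4\<close> but excluded as an optimum, hence
      strictly lighter.\<close>
    have "a x x + a y y + a z z + a w w < d4" "a x x + a y y + 2 * a z w < d4"
      "2 * a x y + 2 * a z w < d4" "a x y + a y z + a z x + a w w < d4"
      using loops4[OF d] not_loops[OF d] edge4[OF d] not_edge[OF d]
        edges4[OF d] not_edges[OF d] triangle4[OF d] not_triangle[OF d]
      by (simp_all only: less_le not_sym simp_thms)
    moreover assume "(\<Sum>i\<in>S. a i (\<sigma> i)) \<le> a x x + a y y + a z z + a w w \<or>
      (\<Sum>i\<in>S. a i (\<sigma> i)) \<le> a x x + a y y + 2 * a z w \<or>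
      (\<Sum>i\<in>S. a i (\<sigma> i)) \<le> 2 * a x y + 2 * a z w \<or>
      (\<Sum>i\<in>S. a i (\<sigma> i)) \<le> a x y + a y z + a z x + a w w"
    ultimately show False
      unfolding S(3)[symmetric] by linarith
  qed (rule sym)
qed

section \<open>Truncation and passage to the limit\<close>

theorem theorem4p2:
  fixes A :: "ereal ^ 'n ^ 'n"
  assumes "CARD('n) \<ge> 4"
    and "tropical_matrix A"
    and "\<forall>i j. A $ i $ j = A $ j $ i"
  shows "charcoeff A 4 + charcoeff A 2 \<le> 2 * charcoeff A 3
       \<or> charcoeff A 4 + 2 * charcoeff A 1 \<le> 3 * charcoeff A 2"
proof (rule ccontr)
  assume neg: "\<not> ?thesis"
  define B :: "nat \<Rightarrow> ereal ^ 'n ^ 'n" where "B N = (\<chi> i j. max (A $ i $ j) (- ereal (real N)))" for N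
  have "(\<lambda>N. - ereal (real N)) \<longlonglongrightarrow> - \<infinity>"
    by (intro tendsto_uminus_ereal id_nat_ereal_tendsto_PInf)
  then have "(\<lambda>N. max (A $ i $ j) (- ereal (real N))) \<longlonglongrightarrow> max (A $ i $ j) (- \<infinity>)" for i j
    by (intro tendsto_max tendsto_const)
  then have "(\<lambda>N. B N $ i $ j) \<longlonglongrightarrow> A $ i $ j" for i j
    by (simp add: B_def)
  then have lim: "(\<lambda>N. charcoeff (B N) k) \<longlonglongrightarrow> charcoeff A k" if "k \<le> 4" for k
    using that assms by (intro tendsto_charcoeff) auto
  have fin: "charcoeff A k \<noteq> \<infinity>" if "k \<le> 4" for k
    using charcoeff_neq_PInf[OF assms(2)] that assms(1) by simp
  have ev: "\<forall>\<^sub>F N in sequentially. f N < g N"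
    if "f \<longlonglongrightarrow> l" "g \<longlonglongrightarrow> m" "l < m" for f g :: "nat \<Rightarrow> ereal" and l m
  proof -
    \<comment> \<open>A separating value works for infinite limits too, where subtraction would
      not.\<close>
    obtain c where "l < c" "c < m" using dense[OF \<open>l < m\<close>] by blast
    then have "\<forall>\<^sub>F N in sequentially. f N < c" "\<forall>\<^sub>F N in sequentially. c < g N"
      using that by (auto dest: order_tendstoD)
    then show ?thesis by eventually_elim simp
  qed
  \<comment> \<open>This keeps addition continuous at the limit even if \<open>charcoeff A 4\<close>
    is -\<infinity>.\<close>
  have fin2: "2 * charcoeff A 1 \<noteq> \<infinity>"
    using fin[of 1] by (cases "charcoeff A 1") auto
  have cmult: "(\<lambda>N. ereal r * charcoeff (B N) k) \<longlonglongrightarrow> ereal r * charcoeff A k" if "k \<le> 4" for r k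
    by (intro tendsto_cmult_ereal lim that) simp
  have "\<forall>\<^sub>F N in sequentially. 2 * charcoeff (B N) 3 < charcoeff (B N) 4 + charcoeff (B N) 2"
  proof (rule ev)
    show "(\<lambda>N. 2 * charcoeff (B N) 3) \<longlonglongrightarrow> 2 * charcoeff A 3"
      using cmult[of 3 2] by simp
    show "(\<lambda>N. charcoeff (B N) 4 + charcoeff (B N) 2) \<longlonglongrightarrow> charcoeff A 4 + charcoeff A 2"
      using fin by (intro tendsto_add_ereal_general lim) auto
  qed (use neg in auto)
  moreover have "\<forall>\<^sub>F N in sequentially. 3 * charcoeff (B N) 2 < charcoeff (B N) 4 + 2 * charcoeff (B N) 1"
  proof (rule ev)
    show "(\<lambda>N. 3 * charcoeff (B N) 2) \<longlonglongrightarrow> 3 * charcoeff A 2"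
      using cmult[of 2 3] by simp
    have "(\<lambda>N. 2 * charcoeff (B N) 1) \<longlonglongrightarrow> 2 * charcoeff A 1"
      using cmult[of 1 2] by simp
    then show "(\<lambda>N. charcoeff (B N) 4 + 2 * charcoeff (B N) 1) \<longlonglongrightarrow> charcoeff A 4 + 2 * charcoeff A 1"
      using fin fin2 by (intro tendsto_add_ereal_general lim) auto
  qed (use neg in auto)
  ultimately have "\<forall>\<^sub>F N in sequentially. False"
  proof eventually_elim
    case (elim N)
    have "B N $ i $ j = ereal (real_of_ereal (B N $ i $ j))" for i j
      using assms(2) by (cases "A $ i $ j") (auto simp: B_def tropical_matrix_def max_def)
    moreover have "B N $ i $ j = B N $ j $ i" for i j
      using assms(3) by (simp add: B_def)
    ultimately show False
      using real_matrix_charcoeff_ineqs[OF assms(1), of "B N" "\<lambda>i j. real_of_ereal (B N $ i $ j)"] elim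
      by (metis not_le)
  qed
  then show False by simp
qed

end
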